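(* Let $\Gamma=F_n$ be a free group of rank $n$. Let $\langle\cdot,\cdot\rangle$ be a symmetric bilinear form of rank $\leqslant 2$ on $H_1(F_n,\mathbb{C})$. Then there exists a smooth deformation of the trivial character, $[\rho_t]$, such that $$\mathrm{Tr}(\rho_t(\gamma))=2+t\langle\gamma,\gamma\rangle+o(t)\quad\text{for all }\gamma\in\Gamma.$$
   Context: In $\langle\gamma,\gamma\rangle$, $\gamma$ stands for its image in $H_1(F_n,\mathbb{C})$. A smooth deformation $[\rho_t]$ of the trivial character is a smooth family, parametrized by $t$ near $0$, of characters $\gamma\mapsto\mathrm{Tr}\,\rho_t(\gamma)$ of representations $\rho_t\colon\Gamma\to\mathrm{SL}_2(\mathbb{C})$, which at $t=0$ is the trivial character, i.e. $\mathrm{Tr}\,\rho_0(\gamma)=2$ for all $\gamma\in\Gamma$. *)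

theory Defs
  imports
    "HOL-Analysis.Analysis"
    "HOL-Algebra.Module"
    "HOL-Library.Function_Algebras"
    "HOL-Library.Landau_Symbols"
begin

section \<open>Free groups of finite rank\<close>

text \<open>A word is a list of letters; \<open>(True, x)\<close> stands for the generator \<open>x\<close> and
  \<open>(False, x)\<close> for its inverse.\<close>

type_synonym 'g word = "(bool \<times> 'g) list"

definition reduced :: "'g word \<Rightarrow> bool"
  where "reduced = successively (\<lambda>(a, x) (b, y). \<not> (x = y \<and> a \<noteq> b))"

fun letter_val :: "('g, 'm) monoid_scheme \<Rightarrow> bool \<times> 'g \<Rightarrow> 'g"
  where "letter_val G (a, x) = (if a then x else inv\<^bsub>G\<^esub> x)"

definition word_val :: "('g, 'm) monoid_scheme \<Rightarrow> 'g word \<Rightarrow> 'g"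
  where "word_val G w = foldr (\<lambda>l y. letter_val G l \<otimes>\<^bsub>G\<^esub> y) w \<one>\<^bsub>G\<^esub>"

text \<open>\<open>S\<close> is a free basis: every element of the group is the value of exactly one
  reduced word in \<open>S\<close>.\<close>

definition free_basis :: "('g, 'm) monoid_scheme \<Rightarrow> 'g set \<Rightarrow> bool"
  where "free_basis G S \<longleftrightarrow>
    S \<subseteq> carrier G \<and> bij_betw (word_val G) {w \<in> lists (UNIV \<times> S). reduced w} (carrier G)"

definition free_group_of_rank :: "nat \<Rightarrow> ('g, 'm) monoid_scheme \<Rightarrow> bool"
  where "free_group_of_rank n G \<longleftrightarrow>
    group G \<and> (\<exists>S. finite S \<and> card S = n \<and> free_basis G S)"


section \<open>First homology with complex coefficients\<close>

definition cscale :: "complex \<Rightarrow> ('x \<Rightarrow> complex) \<Rightarrow> 'x \<Rightarrow> complex"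
  where "cscale c f = (\<lambda>x. c * f x)"

interpretation cfun: vector_space cscale
  by unfold_locales (auto simp: cscale_def fun_eq_iff algebra_simps)

text \<open>Degree one of the bar complex of \<open>G\<close> with trivial coefficients in the complex
  numbers. One-chains are the finitely supported functions on \<open>G\<close>, with basis the
  symbols \<open>[g]\<close> (\<open>chain1 g\<close>). The differential out of degree one is zero, so every chain is a cycle;
  the boundary of the two-chain \<open>[g|h]\<close> is \<open>[h] - [gh] + [g]\<close>.\<close>

definition chain1 :: "'g \<Rightarrow> 'g \<Rightarrow> complex"
  where "chain1 g = indicator {g}"

definition chains1 :: "('g, 'm) monoid_scheme \<Rightarrow> ('g \<Rightarrow> complex) set"
  where "chains1 G = cfun.span (chain1 ` carrier G)"

definition boundaries1 :: "('g, 'm) monoid_scheme \<Rightarrow> ('g \<Rightarrow> complex) set"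
  where "boundaries1 G = cfun.span
    {chain1 h - chain1 (g \<otimes>\<^bsub>G\<^esub> h) + chain1 g | g h. g \<in> carrier G \<and> h \<in> carrier G}"

definition homology_class :: "('g, 'm) monoid_scheme \<Rightarrow> ('g \<Rightarrow> complex) \<Rightarrow> ('g \<Rightarrow> complex) set"
  where "homology_class G c = {c + b | b. b \<in> boundaries1 G}"

text \<open>The quotient vector space \<open>chains1 G / boundaries1 G\<close>. The record type of modules
  extends that of rings; the ring fields \<open>mult\<close> and \<open>one\<close> play no role.\<close>

definition H1 :: "('g, 'm) monoid_scheme \<Rightarrow> (complex, ('g \<Rightarrow> complex) set) module"
  where "H1 G =
    \<lparr>carrier = homology_class G ` chains1 G,
     mult = undefined, one = undefined,
     zero = boundaries1 G,
     add = (\<lambda>X Y. {x + y | x y. x \<in> X \<and> y \<in> Y}),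
     smult = (\<lambda>a X. {cscale a x + b | x b. x \<in> X \<and> b \<in> boundaries1 G})\<rparr>"

definition H1_class :: "('g, 'm) monoid_scheme \<Rightarrow> 'g \<Rightarrow> ('g \<Rightarrow> complex) set"
  where "H1_class G g = homology_class G (chain1 g)"

lemma boundaries1_closed:
  "0 \<in> boundaries1 G"
  "b \<in> boundaries1 G \<Longrightarrow> b' \<in> boundaries1 G \<Longrightarrow> b + b' \<in> boundaries1 G"
  "b \<in> boundaries1 G \<Longrightarrow> b' \<in> boundaries1 G \<Longrightarrow> b - b' \<in> boundaries1 G"
  "b \<in> boundaries1 G \<Longrightarrow> cscale a b \<in> boundaries1 G"
  unfolding boundaries1_def
  by (rule cfun.span_zero cfun.span_add cfun.span_diff cfun.span_scale; assumption)+

lemma chains1_closed: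
  "0 \<in> chains1 G"
  "c \<in> chains1 G \<Longrightarrow> d \<in> chains1 G \<Longrightarrow> c + d \<in> chains1 G"
  "c \<in> chains1 G \<Longrightarrow> cscale a c \<in> chains1 G"
  unfolding chains1_def
  by (rule cfun.span_zero cfun.span_add cfun.span_scale; assumption)+

lemma mem_homology_class: "x \<in> homology_class G c \<longleftrightarrow> x - c \<in> boundaries1 G"
  unfolding homology_class_def
  by (auto simp: algebra_simps) (metis add_diff_cancel_left' diff_add_cancel add.commute)

lemma homology_class_eq_iff:
  "homology_class G c = homology_class G d \<longleftrightarrow> c - d \<in> boundaries1 G"
proof
  assume "homology_class G c = homology_class G d"
  then show "c - d \<in> boundaries1 G"
    using mem_homology_class[of c G c] mem_homology_class[of c G d] boundaries1_closed(1)
    by simp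
next
  assume *: "c - d \<in> boundaries1 G"
  have "x - c \<in> boundaries1 G \<longleftrightarrow> x - d \<in> boundaries1 G" for x
    using boundaries1_closed(2)[OF _ *, of "x - c"] boundaries1_closed(3)[OF _ *, of "x - d"]
    by auto
  then show "homology_class G c = homology_class G d"
    by (auto simp: mem_homology_class)
qed

lemma H1_carrier: "carrier (H1 G) = homology_class G ` chains1 G"
  by (simp add: H1_def)

lemma H1_zero: "\<zero>\<^bsub>H1 G\<^esub> = homology_class G 0"
  by (simp add: H1_def homology_class_def)

lemma H1_add: "homology_class G c \<oplus>\<^bsub>H1 G\<^esub> homology_class G d = homology_class G (c + d)"
proof -
  have 1: "\<exists>x y. z = x + y \<and> x \<in> homology_class G c \<and> y \<in> homology_class G d"
    if "z \<in> homology_class G (c + d)" for z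
    by (rule exI[of _ "z - d"], rule exI[of _ d])
      (use that boundaries1_closed(1) in \<open>simp add: mem_homology_class algebra_simps\<close>)
  have 2: "x + y \<in> homology_class G (c + d)"
    if "x \<in> homology_class G c" "y \<in> homology_class G d" for x y
  proof -
    have "x + y - (c + d) = (x - c) + (y - d)" by simp
    then show ?thesis
      using that boundaries1_closed(2) unfolding mem_homology_class by metis
  qed
  from 1 2 show ?thesis by (auto simp: H1_def)
qed

lemma H1_smult: "a \<odot>\<^bsub>H1 G\<^esub> homology_class G c = homology_class G (cscale a c)"
proof -
  have 1: "\<exists>x b. z = cscale a x + b \<and> x \<in> homology_class G c \<and> b \<in> boundaries1 G"
    if "z \<in> homology_class G (cscale a c)" for z
    by (rule exI[of _ c], rule exI[of _ "z - cscale a c"])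
      (use that boundaries1_closed(1) in \<open>simp add: mem_homology_class\<close>)
  have 2: "cscale a x + b \<in> homology_class G (cscale a c)"
    if "x \<in> homology_class G c" "b \<in> boundaries1 G" for x b
  proof -
    have "cscale a x + b - cscale a c = cscale a (x - c) + b"
      by (simp add: cfun.scale_right_diff_distrib)
    then show ?thesis
      using that boundaries1_closed(2,4) unfolding mem_homology_class by metis
  qed
  from 1 2 show ?thesis by (auto simp: H1_def)
qed

lemma H1_module:
  "module \<lparr>carrier = UNIV, mult = (*), one = 1, zero = 0, add = (+)\<rparr> (H1 G)"
proof (rule moduleI)
  show "cring \<lparr>carrier = UNIV, mult = (*), one = 1, zero = 0, add = (+) :: complex \<Rightarrow> _\<rparr>"
    by (rule cringI)
      (auto intro!: abelian_groupI comm_monoidI simp: algebra_simps,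
        metis add.right_inverse)
  show "abelian_group (H1 G)"
  proof (rule abelian_groupI)
    fix x assume "x \<in> carrier (H1 G)"
    then obtain c where c: "c \<in> chains1 G" "x = homology_class G c"
      by (auto simp: H1_carrier)
    have "cscale (-1) c + c = 0" by (simp add: cscale_def fun_eq_iff)
    with c show "\<exists>y\<in>carrier (H1 G). y \<oplus>\<^bsub>H1 G\<^esub> x = \<zero>\<^bsub>H1 G\<^esub>"
      by (intro bexI[of _ "homology_class G (cscale (-1) c)"])
        (simp_all add: H1_carrier H1_add H1_zero chains1_closed del: cfun.scale_minus_left)
  qed (auto simp: H1_carrier H1_add H1_zero chains1_closed add_ac)
qed (auto simp: H1_carrier H1_add H1_smult chains1_closed cfun.scale_left_distrib
    cfun.scale_right_distrib)


section \<open>Symmetric bilinear forms and their rank\<close>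

definition symmetric_bilinear_form ::
    "(complex, 'v, 'e) module_scheme \<Rightarrow> ('v \<Rightarrow> 'v \<Rightarrow> complex) \<Rightarrow> bool"
  where "symmetric_bilinear_form V B \<longleftrightarrow>
    (\<forall>x\<in>carrier V. \<forall>y\<in>carrier V. B x y = B y x) \<and>
    (\<forall>x\<in>carrier V. \<forall>y\<in>carrier V. \<forall>z\<in>carrier V.
       B (x \<oplus>\<^bsub>V\<^esub> y) z = B x z + B y z \<and> B z (x \<oplus>\<^bsub>V\<^esub> y) = B z x + B z y) \<and>
    (\<forall>a. \<forall>x\<in>carrier V. \<forall>y\<in>carrier V.
       B (a \<odot>\<^bsub>V\<^esub> x) y = a * B x y \<and> B x (a \<odot>\<^bsub>V\<^esub> y) = a * B x y)"

text \<open>The rank of \<open>B\<close> is the dimension of the image of the map \<open>x \<mapsto> B x \<cdot>\<close> from \<open>V\<close> to its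
  dual. Functionals on \<open>V\<close> are extended by zero outside the carrier, so that junk values of
  \<open>B\<close> do not count. The library's \<open>dim\<close> is zero on infinite-dimensional spaces, hence this
  is the rank only when the image is finite-dimensional, in particular when \<open>V\<close> is.\<close>

definition form_rank :: "(complex, 'v, 'e) module_scheme \<Rightarrow> ('v \<Rightarrow> 'v \<Rightarrow> complex) \<Rightarrow> nat"
  where "form_rank V B =
    cfun.dim ((\<lambda>x y. if y \<in> carrier V then B x y else 0) ` carrier V)"


section \<open>Characters and smooth deformations\<close>

definition SL2 :: "(complex^2^2) monoid"
  where "SL2 = \<lparr>carrier = {A. det A = 1}, mult = (**), one = mat 1\<rparr>"

definition representation :: "('g, 'm) monoid_scheme \<Rightarrow> ('g \<Rightarrow> complex^2^2) \<Rightarrow> bool"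
  where "representation G \<rho> \<longleftrightarrow> \<rho> \<in> hom G SL2"

definition character :: "('g \<Rightarrow> complex^2^2) \<Rightarrow> 'g \<Rightarrow> complex"
  where "character \<rho> \<gamma> = trace (\<rho> \<gamma>)"

text \<open>Infinite differentiability on an open set of real parameters; \<open>D k\<close> is the \<open>k\<close>-th
  derivative.\<close>

definition smooth_on :: "real set \<Rightarrow> (real \<Rightarrow> complex) \<Rightarrow> bool"
  where "smooth_on T f \<longleftrightarrow> (\<exists>D :: nat \<Rightarrow> real \<Rightarrow> complex. D 0 = f \<and>
    (\<forall>k. \<forall>t\<in>T. (D k has_vector_derivative D (Suc k) t) (at t)))"

text \<open>The family of representations is only required to have a smooth family of characters,
  with one parameter interval for all group elements. At time zero only the character is
  trivial, not necessarily the representation.\<close>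

definition smooth_deformation_of_trivial_character ::
    "('g, 'm) monoid_scheme \<Rightarrow> (real \<Rightarrow> 'g \<Rightarrow> complex^2^2) \<Rightarrow> bool"
  where "smooth_deformation_of_trivial_character G \<rho> \<longleftrightarrow>
    (\<exists>\<epsilon>>0. (\<forall>t\<in>{-\<epsilon><..<\<epsilon>}. representation G (\<rho> t)) \<and>
       (\<forall>\<gamma>\<in>carrier G. smooth_on {-\<epsilon><..<\<epsilon>} (\<lambda>t. character (\<rho> t) \<gamma>))) \<and>
    (\<forall>\<gamma>\<in>carrier G. character (\<rho> 0) \<gamma> = 2)"

end

theory Submission
  imports Defs
    "HOL-Computational_Algebra.Polynomial"
begin

text \<open>A quadratic form of rank at most \<open>2\<close> over the complex numbers is a product of two linear
  forms: a diagonalisation writes it as \<open>a\<^sup>2 + b\<^sup>2 = (a + \<i> b) (a - \<i> b)\<close>. Hence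
  \<open>\<langle>\<gamma>,\<gamma>\<rangle> = u \<gamma> v \<gamma>\<close> for two homomorphisms \<open>u\<close>, \<open>v\<close> from \<open>\<Gamma>\<close> to the additive group of the
  complex numbers (\<open>quadratic_form_eq_product\<close>).

  To realise this product as a derivative, send each generator \<open>s\<close> to the product of an upper
  and a lower unipotent matrix, with entries \<open>t u s\<close> and \<open>v s\<close> off the diagonal. The factor \<open>t\<close>
  is put on one side only. The more symmetric choice \<open>\<surd>t u s\<close>, \<open>\<surd>t v s\<close> is conjugate to it for
  \<open>t \<noteq> 0\<close> and tends to the trivial representation, but its entries are not smooth. In the chosen
  form all entries are polynomials in \<open>t\<close>, at the price that \<open>\<rho>\<^sub>0\<close> is only unipotent, which
  suffices for its character to be \<open>2\<close>.

  Since \<open>\<Gamma>\<close> is free, the choice on generators extends to one homomorphism \<open>\<Phi>\<close> into the subgroup of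
  \<open>SL\<^sub>2\<close> over the polynomial ring given by the matrices that are lower unipotent at \<open>t = 0\<close>
  (\<open>free_basis_extend_hom\<close>, \<open>group_unipotent_at_0\<close>), and \<open>\<rho>\<^sub>t\<close> is \<open>\<Phi>\<close> evaluated at \<open>t\<close>.
  On that subgroup the first-order coefficient of the upper right entry and the constant
  coefficient of the lower left entry are additive, so for \<open>\<Phi> \<gamma>\<close> they are \<open>u \<gamma>\<close> and \<open>v \<gamma>\<close>. The
  first-order part of \<open>det = 1\<close> equates the first-order coefficient of the trace with their
  product (\<open>unipotent_at_0_trace\<close>).\<close>


section \<open>Homomorphisms out of a free group\<close>

lemma word_val_Nil [simp]: "word_val G [] = \<one>\<^bsub>G\<^esub>"
  by (simp add: word_val_def)

lemma word_val_Cons [simp]: "word_val G (l # w) = letter_val G l \<otimes>\<^bsub>G\<^esub> word_val G w"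
  by (simp add: word_val_def)

lemma letter_val_closed:
  assumes "group G" "l \<in> UNIV \<times> carrier G"
  shows "letter_val G l \<in> carrier G"
  using assms by (cases l) (auto simp: group.inv_closed)

lemma word_val_closed:
  assumes "group G" "w \<in> lists (UNIV \<times> carrier G)"
  shows "word_val G w \<in> carrier G"
proof -
  interpret group G by fact
  from assms(2) show ?thesis
    by (induction w) (auto intro!: letter_val_closed[OF assms(1)])
qed

lemma word_val_append:
  assumes "group G" "v \<in> lists (UNIV \<times> carrier G)" "w \<in> lists (UNIV \<times> carrier G)"
  shows "word_val G (v @ w) = word_val G v \<otimes>\<^bsub>G\<^esub> word_val G w"
proof -
  interpret group G by fact
  have w: "word_val G w \<in> carrier G"
    using assms by (intro word_val_closed)
  from assms(2) show ?thesis
  proof (induction v)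
    case Nil
    with w show ?case by simp
  next
    case (Cons l v)
    then have "letter_val G l \<in> carrier G" "word_val G v \<in> carrier G"
      by (auto intro!: letter_val_closed word_val_closed assms(1))
    with Cons w show ?case by (simp add: m_assoc)
  qed
qed

lemma word_val_cancel:
  assumes "group G" "p @ (a, x) # (\<not> a, x) # q \<in> lists (UNIV \<times> carrier G)"
  shows "word_val G (p @ (a, x) # (\<not> a, x) # q) = word_val G (p @ q)"
proof -
  interpret group G by fact
  have x: "x \<in> carrier G" and p: "p \<in> lists (UNIV \<times> carrier G)"
    and q: "q \<in> lists (UNIV \<times> carrier G)"
    using assms(2) by auto
  have "word_val G q \<in> carrier G" by (intro word_val_closed assms(1) q)
  with x have "word_val G ((a, x) # (\<not> a, x) # q) = word_val G q"
    by (simp flip: m_assoc)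
  moreover have "word_val G (p @ (a, x) # (\<not> a, x) # q)
      = word_val G p \<otimes>\<^bsub>G\<^esub> word_val G ((a, x) # (\<not> a, x) # q)"
    using assms by (intro word_val_append) auto
  ultimately show ?thesis
    using word_val_append[OF assms(1) p q] by simp
qed

lemma not_reducedE:
  assumes "\<not> reduced w"
  obtains p a x q where "w = p @ (a, x) # (\<not> a, x) # q"
proof -
  have "\<exists>p a x q. w = p @ (a, x) # (\<not> a, x) # q"
    using assms unfolding reduced_def
  proof (induction w rule: induct_list012)
    case (3 l m w)
    obtain a x b y where l: "l = (a, x)" and m: "m = (b, y)" by (cases l, cases m)
    show ?case
    proof (cases "x = y \<and> a \<noteq> b")
      case True
      then have "l # m # w = [] @ (a, x) # (\<not> a, x) # w" by (auto simp: l m)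
      then show ?thesis by blast
    next
      case False
      with 3 obtain p a x q where "m # w = p @ (a, x) # (\<not> a, x) # q"
        by (auto simp: l m)
      then have "l # m # w = (l # p) @ (a, x) # (\<not> a, x) # q" by simp
      then show ?thesis by blast
    qed
  qed auto
  with that show thesis by blast
qed

text \<open>Cancelling a pair of mutually inverse letters changes neither the value of a word nor the
  value of its image under a substitution of the letters. This is why a reduced word can stand
  in for \<open>w\<close> in both groups at once.\<close>

lemma ex_reduced_same_values:
  assumes G: "group G" and H: "group H" and S: "S \<subseteq> carrier G" and f: "f ` S \<subseteq> carrier H"
    and w: "w \<in> lists (UNIV \<times> S)"
  shows "\<exists>w' \<in> lists (UNIV \<times> S). reduced w' \<and> word_val G w' = word_val G w \<and>
    word_val H (map (map_prod id f) w') = word_val H (map (map_prod id f) w)"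
  using w
proof (induction "length w" arbitrary: w rule: less_induct)
  case less
  show ?case
  proof (cases "reduced w")
    case False
    then obtain p a x q where w: "w = p @ (a, x) # (\<not> a, x) # q" by (rule not_reducedE)
    let ?m = "map (map_prod id f)"
    have "w \<in> lists (UNIV \<times> carrier G)" "?m w \<in> lists (UNIV \<times> carrier H)"
      using less.prems S f by fastforce+
    then have "word_val G (p @ q) = word_val G w"
      and "word_val H (?m (p @ q)) = word_val H (?m w)"
      using word_val_cancel[OF G, of p a x q] word_val_cancel[OF H, of "?m p" a "f x" "?m q"]
      by (auto simp: w)
    moreover have "length (p @ q) < length w" "p @ q \<in> lists (UNIV \<times> S)"
      using less.prems by (auto simp: w)
    ultimately show ?thesis using less.hyps[of "p @ q"] by simp
  qed (use less.prems in blast)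
qed

text \<open>The universal property of a free basis. The homomorphism sends \<open>\<gamma>\<close> to the value of
  its reduced word after substitution; it is multiplicative because the concatenation of two
  reduced words has a reduced form with the same value in either group.\<close>

lemma free_basis_extend_hom:
  assumes G: "group G" and H: "group H" and S: "free_basis G S" and f: "f ` S \<subseteq> carrier H"
  shows "\<exists>\<phi> \<in> hom G H. \<forall>s\<in>S. \<phi> s = f s"
proof -
  let ?m = "map (map_prod id f)"
  let ?R = "{w \<in> lists (UNIV \<times> S). reduced w}"
  have SG: "S \<subseteq> carrier G" and bij: "bij_betw (word_val G) ?R (carrier G)"
    using S by (auto simp: free_basis_def)
  define nf where "nf = inv_into ?R (word_val G)"
  have nf: "nf \<gamma> \<in> ?R" "word_val G (nf \<gamma>) = \<gamma>" if "\<gamma> \<in> carrier G" for \<gamma>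
  proof -
    have "\<gamma> \<in> word_val G ` ?R" using that bij_betw_imp_surj_on[OF bij] by simp
    then show "nf \<gamma> \<in> ?R" "word_val G (nf \<gamma>) = \<gamma>"
      unfolding nf_def by (rule inv_into_into, rule f_inv_into_f)
  qed
  define \<phi> where "\<phi> \<gamma> = word_val H (?m (nf \<gamma>))" for \<gamma>
  have mS: "?m w \<in> lists (UNIV \<times> carrier H)" if "w \<in> lists (UNIV \<times> S)" for w
    using that f by fastforce
  have \<phi>_word: "\<phi> (word_val G w) = word_val H (?m w)" if w: "w \<in> lists (UNIV \<times> S)" for w
  proof -
    obtain w' where w': "w' \<in> ?R" "word_val G w' = word_val G w"
        "word_val H (?m w') = word_val H (?m w)"
      using ex_reduced_same_values[OF G H SG f w] by blast
    have "nf (word_val G w) = w'"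
      unfolding nf_def w'(2)[symmetric]
      by (rule inv_into_f_f[OF bij_betw_imp_inj_on[OF bij] w'(1)])
    then show ?thesis using w'(3) by (simp add: \<phi>_def)
  qed
  have "\<phi> \<in> hom G H"
  proof (rule homI)
    fix g assume "g \<in> carrier G"
    then show "\<phi> g \<in> carrier H"
      unfolding \<phi>_def using nf by (intro word_val_closed[OF H] mS) auto
  next
    fix g h assume gh: "g \<in> carrier G" "h \<in> carrier G"
    then have w: "nf g \<in> lists (UNIV \<times> S)" "nf h \<in> lists (UNIV \<times> S)" using nf by auto
    then have wG: "nf g \<in> lists (UNIV \<times> carrier G)" "nf h \<in> lists (UNIV \<times> carrier G)"
      using SG by fastforce+
    have "g \<otimes>\<^bsub>G\<^esub> h = word_val G (nf g @ nf h)"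
      using word_val_append[OF G wG] nf gh by simp
    also have "\<phi> \<dots> = word_val H (?m (nf g) @ ?m (nf h))"
      using \<phi>_word[of "nf g @ nf h"] w by simp
    also have "\<dots> = \<phi> g \<otimes>\<^bsub>H\<^esub> \<phi> h"
      unfolding \<phi>_def using w by (intro word_val_append[OF H] mS)
    finally show "\<phi> (g \<otimes>\<^bsub>G\<^esub> h) = \<phi> g \<otimes>\<^bsub>H\<^esub> \<phi> h" .
  qed
  moreover have "\<phi> s = f s" if s: "s \<in> S" for s
  proof -
    have "s \<in> carrier G" "f s \<in> carrier H" using s SG f by auto
    then show ?thesis
      using \<phi>_word[of "[(True, s)]"] s G H by (simp add: group.is_monoid monoid.r_one)
  qed
  ultimately show ?thesis by blast
qed

lemma free_basis_induct [consumes 3, case_names one basis mult inv]: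
  assumes G: "group G" and S: "free_basis G S" and \<gamma>: "\<gamma> \<in> carrier G"
    and one: "P \<one>\<^bsub>G\<^esub>"
    and basis: "\<And>s. s \<in> S \<Longrightarrow> P s"
    and mult: "\<And>g h. g \<in> carrier G \<Longrightarrow> h \<in> carrier G \<Longrightarrow> P g \<Longrightarrow> P h \<Longrightarrow> P (g \<otimes>\<^bsub>G\<^esub> h)"
    and inv: "\<And>g. g \<in> carrier G \<Longrightarrow> P g \<Longrightarrow> P (inv\<^bsub>G\<^esub> g)"
  shows "P \<gamma>"
proof -
  interpret group G by fact
  have SG: "S \<subseteq> carrier G" using S by (auto simp: free_basis_def)
  have "P (word_val G w)" if "w \<in> lists (UNIV \<times> S)" for w
    using that
  proof (induction w)
    case (Cons l w)
    have "l \<in> UNIV \<times> carrier G" "w \<in> lists (UNIV \<times> carrier G)"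
      using Cons.hyps SG by fastforce+
    moreover have "P (letter_val G l)"
      using Cons.hyps SG basis inv by (cases l) auto
    ultimately show ?case
      using Cons.IH by (auto intro!: mult letter_val_closed word_val_closed G)
  qed (simp add: one)
  moreover have "\<gamma> \<in> word_val G ` {w \<in> lists (UNIV \<times> S). reduced w}"
    using S \<gamma> bij_betw_imp_surj_on by (fastforce simp: free_basis_def)
  ultimately show ?thesis by blast
qed

lemma additive_eqI_free_basis:
  fixes u v :: "'g \<Rightarrow> complex"
  assumes G: "group G" and S: "free_basis G S"
    and u: "\<And>g h. g \<in> carrier G \<Longrightarrow> h \<in> carrier G \<Longrightarrow> u (g \<otimes>\<^bsub>G\<^esub> h) = u g + u h"
    and v: "\<And>g h. g \<in> carrier G \<Longrightarrow> h \<in> carrier G \<Longrightarrow> v (g \<otimes>\<^bsub>G\<^esub> h) = v g + v h"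
    and uv: "\<And>s. s \<in> S \<Longrightarrow> u s = v s" and \<gamma>: "\<gamma> \<in> carrier G"
  shows "u \<gamma> = v \<gamma>"
proof -
  interpret group G by fact
  have one: "u \<one>\<^bsub>G\<^esub> = 0" "v \<one>\<^bsub>G\<^esub> = 0"
    using u[of "\<one>\<^bsub>G\<^esub>" "\<one>\<^bsub>G\<^esub>"] v[of "\<one>\<^bsub>G\<^esub>" "\<one>\<^bsub>G\<^esub>"] by auto
  from G S \<gamma> show ?thesis
  proof (induction rule: free_basis_induct)
    case (inv g)
    then have "u g + u (inv\<^bsub>G\<^esub> g) = v g + v (inv\<^bsub>G\<^esub> g)"
      using u[of g "inv\<^bsub>G\<^esub> g"] v[of g "inv\<^bsub>G\<^esub> g"] one by simp
    with inv show ?case by simp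
  qed (simp_all add: one uv u v)
qed


section \<open>Matrices over the polynomial ring\<close>

text \<open>The polynomial variable is the deformation parameter \<open>t\<close>, and the conditions on the constant
  coefficients say that the matrix at \<open>t = 0\<close> is lower triangular with diagonal \<open>1\<close>.\<close>

definition unipotent_at_0 :: "(complex poly^2^2) monoid"
  where "unipotent_at_0 =
    \<lparr>carrier = {A. det A = 1 \<and> coeff (A $ 1 $ 1) 0 = 1 \<and> coeff (A $ 1 $ 2) 0 = 0 \<and>
       coeff (A $ 2 $ 2) 0 = 1},
     mult = (**), one = mat 1\<rparr>"

lemma matrix_mult_2:
  "((A :: 'a::semiring_1^2^2) ** C) $ i $ j = A $ i $ 1 * C $ 1 $ j + A $ i $ 2 * C $ 2 $ j"
  by (simp add: matrix_matrix_mult_def sum_2)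

lemma group_unipotent_at_0: "group unipotent_at_0"
proof (rule groupI)
  fix A assume A: "A \<in> carrier unipotent_at_0"
  \<comment> \<open>the adjugate matrix\<close>
  define A' :: "complex poly^2^2"
    where "A' = vector [vector [A $ 2 $ 2, - A $ 1 $ 2], vector [- A $ 2 $ 1, A $ 1 $ 1]]"
  have "A' \<in> carrier unipotent_at_0"
    using A by (simp add: unipotent_at_0_def A'_def det_2 algebra_simps)
  moreover have "A' ** A = mat 1"
    using A by (simp add: vec_eq_iff forall_2 matrix_mult_2 mat_def A'_def unipotent_at_0_def
      det_2 algebra_simps)
  ultimately show "\<exists>A'\<in>carrier unipotent_at_0.
      A' \<otimes>\<^bsub>unipotent_at_0\<^esub> A = \<one>\<^bsub>unipotent_at_0\<^esub>"
    by (auto simp: unipotent_at_0_def)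
next
  show "\<one>\<^bsub>unipotent_at_0\<^esub> \<in> carrier unipotent_at_0"
    by (simp add: unipotent_at_0_def) (simp add: mat_def)
qed (auto simp: unipotent_at_0_def det_mul matrix_mul_assoc,
  auto simp: matrix_mult_2 coeff_mult_0)

lemma coeff_mult_1: "coeff (p * q) 1 = coeff p 0 * coeff q 1 + coeff p 1 * coeff q 0"
  by (simp add: coeff_mult)

text \<open>At \<open>t = 0\<close> the matrices are lower unipotent, and multiplying these adds the lower left
  entries.\<close>

lemma unipotent_at_0_lower_mult:
  assumes "A \<in> carrier unipotent_at_0" "C \<in> carrier unipotent_at_0"
  shows "coeff ((A \<otimes>\<^bsub>unipotent_at_0\<^esub> C) $ 2 $ 1) 0 = coeff (A $ 2 $ 1) 0 + coeff (C $ 2 $ 1) 0"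
  using assms by (simp add: unipotent_at_0_def matrix_mult_2 coeff_mult_0)

text \<open>The upper right entries start with \<open>t\<close>, so only the values at \<open>t = 0\<close> of the diagonal entries
  they are multiplied with, which are \<open>1\<close>, contribute to first order.\<close>

lemma unipotent_at_0_upper_mult:
  assumes "A \<in> carrier unipotent_at_0" "C \<in> carrier unipotent_at_0"
  shows "coeff ((A \<otimes>\<^bsub>unipotent_at_0\<^esub> C) $ 1 $ 2) 1 = coeff (A $ 1 $ 2) 1 + coeff (C $ 1 $ 2) 1"
  using assms by (simp add: unipotent_at_0_def matrix_mult_2 coeff_mult_1 del: One_nat_def)

text \<open>Because the diagonal entries are \<open>1\<close> at \<open>t = 0\<close>, the first-order coefficient of their product
  is that of their sum. In \<open>det A = 1\<close> this has to cancel the first-order coefficient of the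
  product of the other two entries.\<close>

lemma unipotent_at_0_trace:
  assumes "A \<in> carrier unipotent_at_0"
  shows "coeff (trace A) 0 = 2"
    and "coeff (trace A) 1 = coeff (A $ 1 $ 2) 1 * coeff (A $ 2 $ 1) 0"
proof -
  have A: "coeff (A $ 1 $ 1) 0 = 1" "coeff (A $ 1 $ 2) 0 = 0" "coeff (A $ 2 $ 2) 0 = 1"
    "det A = 1"
    using assms by (auto simp: unipotent_at_0_def)
  show "coeff (trace A) 0 = 2" by (simp add: trace_def sum_2 A)
  have "coeff (det A) 1 = 0" by (simp add: A)
  then show "coeff (trace A) 1 = coeff (A $ 1 $ 2) 1 * coeff (A $ 2 $ 1) 0"
    by (simp add: trace_def sum_2 det_2 coeff_mult_1 A algebra_simps del: One_nat_def)
qed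

definition eval_matrix :: "real \<Rightarrow> complex poly^2^2 \<Rightarrow> complex^2^2"
  where "eval_matrix t A = (\<chi> i j. poly (A $ i $ j) (complex_of_real t))"

lemma eval_matrix_hom: "eval_matrix t \<in> hom unipotent_at_0 SL2"
proof (rule homI)
  fix A assume "A \<in> carrier unipotent_at_0"
  then have "poly (det A) (complex_of_real t) = 1" by (simp add: unipotent_at_0_def)
  then show "eval_matrix t A \<in> carrier SL2"
    by (simp add: SL2_def eval_matrix_def det_2)
qed (simp add: unipotent_at_0_def SL2_def eval_matrix_def vec_eq_iff matrix_mult_2)

lemma trace_eval_matrix: "trace (eval_matrix t A) = poly (trace A) (complex_of_real t)"
  by (simp add: trace_def eval_matrix_def sum_2)

lemma smooth_on_poly: "smooth_on T (\<lambda>t. poly p (complex_of_real t))"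
  unfolding smooth_on_def
proof (intro exI conjI allI ballI)
  fix k :: nat and t :: real
  show "((\<lambda>t. poly ((pderiv ^^ k) p) (complex_of_real t)) has_vector_derivative
      poly ((pderiv ^^ Suc k) p) (complex_of_real t)) (at t)"
    by (auto intro!: has_vector_derivative_real_field poly_DERIV)
qed simp

lemma poly_smallo_linear:
  assumes "coeff p 0 = 0" "coeff p 1 = 0"
  shows "(\<lambda>t. poly p (complex_of_real t)) \<in> o[at 0](\<lambda>t. complex_of_real t)"
proof -
  obtain q where p: "p = pCons 0 (pCons 0 q)"
    using assms by (cases p; rename_tac a p'; case_tac p') auto
  have "((\<lambda>t. complex_of_real t * poly q (complex_of_real t)) \<longlongrightarrow>
      complex_of_real 0 * poly q (complex_of_real 0)) (at 0)"
    by (intro tendsto_intros)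
  moreover have "\<forall>\<^sub>F t in at 0. complex_of_real t * poly q (complex_of_real t)
      = poly p (complex_of_real t) / complex_of_real t"
    by (auto simp: p eventually_at_filter)
  ultimately have "((\<lambda>t. poly p (complex_of_real t) / complex_of_real t) \<longlongrightarrow> 0) (at 0)"
    using Lim_transform_eventually by fastforce
  then show ?thesis
    by (rule smalloI_tendsto) (auto simp: eventually_at_filter)
qed


section \<open>Symmetric bilinear forms of small rank\<close>

text \<open>Gram-Schmidt without a basis. An orthogonal set \<open>E\<close> of anisotropic vectors that has
  the largest possible size gives the diagonal form: by maximality, whatever remains of \<open>x\<close> after
  its projection to the span of \<open>E\<close> is isotropic. The maximum exists by a bound on the size of such
  sets rather than on the dimension, because the lemma is for one-chains, which in general form a
  space of infinite dimension.\<close>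

lemma ex_orthogonal_diagonalisation:
  fixes \<beta> :: "('x \<Rightarrow> complex) \<Rightarrow> ('x \<Rightarrow> complex) \<Rightarrow> complex"
  assumes U: "cfun.subspace U"
    and sym: "\<And>x y. x \<in> U \<Longrightarrow> y \<in> U \<Longrightarrow> \<beta> x y = \<beta> y x"
    and add: "\<And>x y z. x \<in> U \<Longrightarrow> y \<in> U \<Longrightarrow> z \<in> U \<Longrightarrow> \<beta> (x + y) z = \<beta> x z + \<beta> y z"
    and scale: "\<And>a x z. x \<in> U \<Longrightarrow> z \<in> U \<Longrightarrow> \<beta> (cscale a x) z = a * \<beta> x z"
    and bound: "\<And>E. finite E \<Longrightarrow> E \<subseteq> U \<Longrightarrow>
      (\<And>e. e \<in> E \<Longrightarrow> \<beta> e e \<noteq> 0) \<Longrightarrow> pairwise (\<lambda>e f. \<beta> e f = 0) E \<Longrightarrow> card E \<le> r"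
  shows "\<exists>E. finite E \<and> E \<subseteq> U \<and> card E \<le> r \<and>
    (\<forall>x\<in>U. \<beta> x x = (\<Sum>e\<in>E. (\<beta> x e)\<^sup>2 / \<beta> e e))"
proof -
  define P where "P E \<longleftrightarrow> finite E \<and> E \<subseteq> U \<and> (\<forall>e\<in>E. \<beta> e e \<noteq> 0) \<and>
    pairwise (\<lambda>e f. \<beta> e f = 0) E" for E
  have le: "card E \<le> r" if "P E" for E
    using that bound[of E] by (auto simp: P_def)
  have "P {}" by (simp add: P_def)
  moreover have "\<forall>E. P E \<longrightarrow> card E < Suc r" using le by (simp add: less_Suc_eq_le)
  ultimately obtain E where E: "P E" and max: "\<And>E'. P E' \<Longrightarrow> card E' \<le> card E"
    using ex_has_greatest_nat[of P "{}" card "Suc r"] by blast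
  from E have fin: "finite E" and EU: "E \<subseteq> U" and E0: "\<And>e. e \<in> E \<Longrightarrow> \<beta> e e \<noteq> 0"
    and orth: "\<And>e f. e \<in> E \<Longrightarrow> f \<in> E \<Longrightarrow> e \<noteq> f \<Longrightarrow> \<beta> e f = 0"
    by (auto simp: P_def pairwise_def)
  have sum_mem: "(\<Sum>e\<in>F. cscale (a e) e) \<in> U" if "F \<subseteq> U" for F a
    using that by (auto intro!: cfun.subspace_sum cfun.subspace_scale U)
  have \<beta>0: "\<beta> 0 z = 0" if "z \<in> U" for z
    using scale[OF that that, of 0] by simp
  have \<beta>_sum: "\<beta> (\<Sum>e\<in>F. cscale (a e) e) z = (\<Sum>e\<in>F. a e * \<beta> e z)"
    if "finite F" "F \<subseteq> U" "z \<in> U" for F a z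
    using that
    by (induction F) (auto simp: \<beta>0 add scale sum_mem cfun.subspace_scale[OF U])
  have "\<beta> x x = (\<Sum>e\<in>E. (\<beta> x e)\<^sup>2 / \<beta> e e)" if x: "x \<in> U" for x
  proof -
    define p where "p = (\<Sum>e\<in>E. cscale (\<beta> x e / \<beta> e e) e)"
    define y where "y = x - p"
    have p: "p \<in> U" unfolding p_def by (rule sum_mem[OF EU])
    have y: "y \<in> U" unfolding y_def by (rule cfun.subspace_diff[OF U x p])
    have x_eq: "\<beta> x z = \<beta> y z + \<beta> p z" if "z \<in> U" for z
      using add[OF y p that] by (simp add: y_def)
    have ye: "\<beta> y e = 0" if e: "e \<in> E" for e
    proof -
      have "\<beta> p e = (\<Sum>f\<in>E. if f = e then \<beta> x e else 0)"
        unfolding p_def using e EU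
        by (subst \<beta>_sum[OF fin EU]) (auto simp: orth E0 intro!: sum.cong)
      with e fin EU x_eq[of e] show ?thesis by auto
    qed
    have py: "\<beta> p y = 0"
      unfolding p_def using EU y ye sym[OF _ y]
      by (subst \<beta>_sum[OF fin EU y]) (auto intro!: sum.neutral)
    have "\<beta> y y = 0"
    proof (rule ccontr)
      assume yy: "\<beta> y y \<noteq> 0"
      with ye have "y \<notin> E" by auto
      have "\<beta> e y = 0" if "e \<in> E" for e using sym[of e y] ye that EU y by auto
      with yy ye E y have "P (insert y E)"
        by (auto simp: P_def pairwise_insert)
      with max[of "insert y E"] \<open>y \<notin> E\<close> fin show False by simp
    qed
    then have "\<beta> x x = \<beta> p x"
      using x_eq[OF x] x_eq[OF y] py sym[OF x y] by simp
    also have "\<dots> = (\<Sum>e\<in>E. (\<beta> x e)\<^sup>2 / \<beta> e e)"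
      unfolding p_def using fin EU x sym
      by (subst \<beta>_sum) (auto simp: power2_eq_square intro!: sum.cong)
    finally show ?thesis .
  qed
  with fin EU le[OF E] show ?thesis by blast
qed

lemma cscale_apply: "cscale a f x = a * f x"
  by (simp add: cscale_def)

lemma chain1_mem: "g \<in> carrier G \<Longrightarrow> chain1 g \<in> chains1 G"
  unfolding chains1_def by (intro cfun.span_base) auto

lemma H1_class_mult:
  assumes "g \<in> carrier G" "h \<in> carrier G"
  shows "H1_class G (g \<otimes>\<^bsub>G\<^esub> h) = H1_class G g \<oplus>\<^bsub>H1 G\<^esub> H1_class G h"
proof -
  have "chain1 h - chain1 (g \<otimes>\<^bsub>G\<^esub> h) + chain1 g \<in> boundaries1 G"
    unfolding boundaries1_def using assms by (intro cfun.span_base) auto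
  then have "(chain1 g + chain1 h) - chain1 (g \<otimes>\<^bsub>G\<^esub> h) \<in> boundaries1 G"
    by (simp add: algebra_simps)
  then show ?thesis
    unfolding H1_class_def H1_add by (metis homology_class_eq_iff)
qed

text \<open>The form is pulled back along \<open>homology_class\<close> to the space of one-chains, where the vector space
  operations are those of functions instead of the record operations of \<open>H1\<close>.\<close>

context
  fixes G :: "('g, 'm) monoid_scheme" and S :: "'g set"
    and B :: "('g \<Rightarrow> complex) set \<Rightarrow> ('g \<Rightarrow> complex) set \<Rightarrow> complex"
  assumes G: "group G" and S: "free_basis G S" and fin: "finite S"
    and B: "symmetric_bilinear_form (H1 G) B"
begin

text \<open>Extension by zero makes these functions the elements of the space whose dimension is
  \<open>form_rank (H1 G) B\<close>.\<close>

definition functional :: "('g \<Rightarrow> complex) \<Rightarrow> ('g \<Rightarrow> complex) set \<Rightarrow> complex"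
  where "functional c = (\<lambda>y. if y \<in> carrier (H1 G) then B (homology_class G c) y else 0)"

lemma functional_add:
  assumes "c \<in> chains1 G" "d \<in> chains1 G"
  shows "functional (c + d) = functional c + functional d"
  using assms B by (auto simp: functional_def fun_eq_iff symmetric_bilinear_form_def H1_carrier
    simp flip: H1_add)

lemma functional_scale:
  assumes "c \<in> chains1 G"
  shows "functional (cscale a c) = cscale a (functional c)"
  using assms B by (auto simp: functional_def fun_eq_iff symmetric_bilinear_form_def H1_carrier
    cscale_apply simp flip: H1_smult)

lemma functional_apply:
  "d \<in> chains1 G \<Longrightarrow> functional c (homology_class G d) = B (homology_class G c) (homology_class G d)"
  by (simp add: functional_def H1_carrier)

lemma functional_sym:
  "c \<in> chains1 G \<Longrightarrow> d \<in> chains1 G \<Longrightarrow>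
    functional c (homology_class G d) = functional d (homology_class G c)"
  using B by (simp add: functional_apply symmetric_bilinear_form_def H1_carrier)

lemma functional_chain1_mult:
  assumes "g \<in> carrier G" "h \<in> carrier G"
  shows "functional (chain1 (g \<otimes>\<^bsub>G\<^esub> h)) = functional (chain1 g) + functional (chain1 h)"
proof -
  have "homology_class G (chain1 (g \<otimes>\<^bsub>G\<^esub> h)) = homology_class G (chain1 g + chain1 h)"
    using H1_class_mult[OF assms] by (simp add: H1_class_def H1_add)
  then have "functional (chain1 (g \<otimes>\<^bsub>G\<^esub> h)) = functional (chain1 g + chain1 h)"
    unfolding functional_def by (rule arg_cong)
  then show ?thesis using assms by (simp add: functional_add chain1_mem)
qed

text \<open>This makes the space of functionals finite-dimensional, so that \<open>form_rank\<close>, defined by a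
  dimension that is zero by convention on infinite-dimensional spaces, is the true rank.\<close>

lemma functional_mem_span_basis:
  assumes "c \<in> chains1 G"
  shows "functional c \<in> cfun.span ((\<lambda>s. functional (chain1 s)) ` S)" (is "_ \<in> cfun.span ?T")
proof -
  interpret group G by (rule G)
  have fun_one: "functional (chain1 \<one>\<^bsub>G\<^esub>) = 0"
    using functional_chain1_mult[of "\<one>\<^bsub>G\<^esub>" "\<one>\<^bsub>G\<^esub>"] by simp
  have gen: "functional (chain1 g) \<in> cfun.span ?T" if "g \<in> carrier G" for g
    using G S that
  proof (induction rule: free_basis_induct)
    case (inv g)
    then have "functional (chain1 g) + functional (chain1 (inv\<^bsub>G\<^esub> g)) = 0"
      using functional_chain1_mult[of g "inv\<^bsub>G\<^esub> g"] fun_one by simp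
    then have "functional (chain1 (inv\<^bsub>G\<^esub> g)) = - functional (chain1 g)"
      by (metis add.inverse_unique)
    moreover have "- functional (chain1 g) \<in> cfun.span ?T"
      using inv by (intro cfun.span_neg)
    ultimately show ?case by metis
  next
    case (mult g h)
    then show ?case
      unfolding functional_chain1_mult[OF mult(1,2)] by (intro cfun.span_add)
  next
    case one
    show ?case unfolding fun_one by (rule cfun.span_zero)
  qed (auto intro: cfun.span_base)
  have zero: "functional 0 = 0"
    using functional_scale[OF chains1_closed(1), of 0] by simp
  have "c \<in> chains1 G \<and> functional c \<in> cfun.span ?T"
    using assms unfolding chains1_def
  proof (induction c rule: cfun.span_induct_alt)
    case base
    show ?case unfolding zero by (intro conjI cfun.span_zero)
  next
    case (step a x y)
    then obtain g where g: "g \<in> carrier G" "x = chain1 g" by blast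
    then have x: "x \<in> chains1 G" "functional x \<in> cfun.span ?T"
      using gen chain1_mem by auto
    have y: "y \<in> chains1 G" "functional y \<in> cfun.span ?T"
      using step unfolding chains1_def by blast+
    have "functional (cscale a x + y) = cscale a (functional x) + functional y"
      unfolding functional_add[OF chains1_closed(3)[OF x(1)] y(1)] functional_scale[OF x(1)] ..
    moreover have "cscale a (functional x) + functional y \<in> cfun.span ?T"
      by (intro cfun.span_add cfun.span_scale x y)
    moreover have "cscale a x + y \<in> chains1 G"
      by (intro chains1_closed x y)
    ultimately show ?case unfolding chains1_def by metis
  qed
  then show ?thesis ..
qed

text \<open>Evaluating a linear relation between the functionals at one member of \<open>E\<close> isolates its
  coefficient, so the functionals are linearly independent.\<close>

lemma card_orthogonal_le_form_rank:
  assumes E: "finite E" "E \<subseteq> chains1 G"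
    and E0: "\<And>e. e \<in> E \<Longrightarrow> functional e (homology_class G e) \<noteq> 0"
    and orth: "pairwise (\<lambda>e f. functional e (homology_class G f) = 0) E"
  shows "card E \<le> form_rank (H1 G) B"
proof -
  have inj: "inj_on functional E"
    using E0 orth unfolding inj_on_def pairwise_def by metis
  have "cfun.independent (functional ` E)"
    unfolding cfun.independent_explicit_finite_subsets
  proof (intro allI impI ballI)
    fix A a x
    assume A: "A \<subseteq> functional ` E" "finite A" and sum0: "(\<Sum>v\<in>A. cscale (a v) v) = 0"
      and x: "x \<in> A"
    from A x obtain e where e: "e \<in> E" "x = functional e" by auto
    have "0 = (\<Sum>v\<in>A. cscale (a v) v) (homology_class G e)" by (simp add: sum0)
    also have "\<dots> = (\<Sum>v\<in>A. a v * v (homology_class G e))"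
      using A(2) by (induction A) (auto simp: cscale_def)
    also have "\<dots> = (\<Sum>v\<in>A. if v = x then a x * x (homology_class G e) else 0)"
    proof (rule sum.cong[OF refl])
      fix v assume "v \<in> A"
      then obtain f where f: "f \<in> E" "v = functional f" using A by auto
      then show "a v * v (homology_class G e) = (if v = x then a x * x (homology_class G e) else 0)"
        using orth e by (cases "f = e") (auto simp: pairwise_def)
    qed
    also have "\<dots> = a x * x (homology_class G e)" using A x by simp
    finally show "a x = 0" using E0[of e] e by simp
  qed
  moreover
  define W where "W = functional ` chains1 G"
  have W: "form_rank (H1 G) B = cfun.dim W"
    by (simp add: form_rank_def W_def H1_carrier image_image functional_def[abs_def])
  obtain b where b: "b \<subseteq> W" "cfun.independent b" "W \<subseteq> cfun.span b" "card b = cfun.dim W"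
    using cfun.basis_exists[of W] by blast
  have "b \<subseteq> cfun.span ((\<lambda>s. functional (chain1 s)) ` S)"
    using b(1) functional_mem_span_basis by (auto simp: W_def)
  then have "finite b"
    using cfun.independent_span_bound b(2) fin by blast
  moreover have "functional ` E \<subseteq> cfun.span b"
    using E(2) b(3) by (auto simp: W_def)
  ultimately have "card (functional ` E) \<le> card b"
    using cfun.independent_span_bound by blast
  then show ?thesis using card_image[OF inj] W b(4) by simp
qed

lemma quadratic_form_eq_product:
  assumes rank: "form_rank (H1 G) B \<le> 2"
  shows "\<exists>u v. (\<forall>g\<in>carrier G. \<forall>h\<in>carrier G.
      u (g \<otimes>\<^bsub>G\<^esub> h) = u g + u h \<and> v (g \<otimes>\<^bsub>G\<^esub> h) = v g + v h) \<and>
    (\<forall>g\<in>carrier G. B (H1_class G g) (H1_class G g) = u g * v g)"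
proof -
  define \<beta> where "\<beta> c d = functional c (homology_class G d)" for c d
  have "\<exists>E. finite E \<and> E \<subseteq> chains1 G \<and> card E \<le> 2 \<and>
      (\<forall>x\<in>chains1 G. \<beta> x x = (\<Sum>e\<in>E. (\<beta> x e)\<^sup>2 / \<beta> e e))"
  proof (rule ex_orthogonal_diagonalisation)
    show "cfun.subspace (chains1 G)" by (simp add: chains1_def cfun.subspace_span)
    show "card E \<le> 2" if "finite E" "E \<subseteq> chains1 G" "\<And>e. e \<in> E \<Longrightarrow> \<beta> e e \<noteq> 0"
      "pairwise (\<lambda>e f. \<beta> e f = 0) E" for E
      using card_orthogonal_le_form_rank[of E] that rank by (simp add: \<beta>_def)
    show "\<beta> x y = \<beta> y x" if "x \<in> chains1 G" "y \<in> chains1 G" for x y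
      unfolding \<beta>_def using that by (rule functional_sym)
    show "\<beta> (x + y) z = \<beta> x z + \<beta> y z" if "x \<in> chains1 G" "y \<in> chains1 G" for x y z
      unfolding \<beta>_def functional_add[OF that] by simp
    show "\<beta> (cscale a x) z = a * \<beta> x z" if "x \<in> chains1 G" for a x z
      unfolding \<beta>_def functional_scale[OF that] by (rule cscale_apply)
  qed
  then obtain E where E: "finite E" "card E \<le> 2"
    and diag: "\<And>x. x \<in> chains1 G \<Longrightarrow> \<beta> x x = (\<Sum>e\<in>E. (\<beta> x e)\<^sup>2 / \<beta> e e)"
    by auto
  \<comment> \<open>dividing by the root normalises the diagonal form to a sum of at most two squares\<close>
  define l where "l e g = \<beta> (chain1 g) e / csqrt (\<beta> e e)" for e g
  have l_add: "l e (g \<otimes>\<^bsub>G\<^esub> h) = l e g + l e h" if "g \<in> carrier G" "h \<in> carrier G" for e g h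
    using that by (simp add: l_def \<beta>_def functional_chain1_mult add_divide_distrib)
  have sq: "B (H1_class G g) (H1_class G g) = (\<Sum>e\<in>E. (l e g)\<^sup>2)" if "g \<in> carrier G" for g
    using diag[OF chain1_mem[OF that]] that
    by (simp add: l_def power_divide H1_class_def \<beta>_def functional_apply chain1_mem)
  from E(2) consider "card E = 0" | "card E = 1" | "card E = 2" by linarith
  then show ?thesis
  proof cases
    case 1
    with E sq show ?thesis by (intro exI[of _ "\<lambda>_. 0"]) auto
  next
    case 2
    then obtain e where "E = {e}" by (auto simp: card_1_singleton_iff)
    with sq l_add show ?thesis
      by (intro exI[of _ "l e"]) (auto simp: power2_eq_square)
  next
    case 3
    then obtain e f where "E = {e, f}" "e \<noteq> f" by (auto simp: card_2_iff)
    with sq have "B (H1_class G g) (H1_class G g) = (l e g + \<i> * l f g) * (l e g - \<i> * l f g)"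
      if "g \<in> carrier G" for g
      using that by (simp add: power2_eq_square algebra_simps)
    then show ?thesis using l_add
      by (intro exI[of _ "\<lambda>g. l e g + \<i> * l f g"] exI[of _ "\<lambda>g. l e g - \<i> * l f g"])
         (auto simp: algebra_simps)
  qed
qed

end


section \<open>The deformation\<close>

lemma ex_hom_unipotent_at_0:
  assumes G: "group G" and S: "free_basis G S"
    and u: "\<And>g h. g \<in> carrier G \<Longrightarrow> h \<in> carrier G \<Longrightarrow> u (g \<otimes>\<^bsub>G\<^esub> h) = u g + u h"
    and v: "\<And>g h. g \<in> carrier G \<Longrightarrow> h \<in> carrier G \<Longrightarrow> v (g \<otimes>\<^bsub>G\<^esub> h) = v g + v h"
  shows "\<exists>\<Phi> \<in> hom G unipotent_at_0. \<forall>\<gamma>\<in>carrier G.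
    coeff (\<Phi> \<gamma> $ 1 $ 2) 1 = u \<gamma> \<and> coeff (\<Phi> \<gamma> $ 2 $ 1) 0 = v \<gamma>"
proof -
  \<comment> \<open>the product of the upper unipotent matrix with entry \<open>t u s\<close> and the lower one with entry \<open>v s\<close>\<close>
  define f :: "_ \<Rightarrow> complex poly^2^2"
    where "f s = vector [vector [[:1, u s * v s:], [:0, u s:]], vector [[:v s:], 1]]" for s
  have "f ` S \<subseteq> carrier unipotent_at_0"
    by (auto simp: f_def unipotent_at_0_def det_2 one_pCons)
  then obtain \<Phi> where \<Phi>: "\<Phi> \<in> hom G unipotent_at_0" and \<Phi>S: "\<And>s. s \<in> S \<Longrightarrow> \<Phi> s = f s"
    using free_basis_extend_hom[OF G group_unipotent_at_0 S] by blast
  have mem: "\<Phi> g \<in> carrier unipotent_at_0" if "g \<in> carrier G" for g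
    using \<Phi> that by (rule hom_in_carrier)
  have "coeff (\<Phi> \<gamma> $ 1 $ 2) 1 = u \<gamma>" if "\<gamma> \<in> carrier G" for \<gamma>
    using G S _ u _ that
    by (rule additive_eqI_free_basis)
       (simp_all add: hom_mult[OF \<Phi>] unipotent_at_0_upper_mult mem \<Phi>S f_def del: One_nat_def, simp)
  moreover have "coeff (\<Phi> \<gamma> $ 2 $ 1) 0 = v \<gamma>" if "\<gamma> \<in> carrier G" for \<gamma>
    using G S _ v _ that
    by (rule additive_eqI_free_basis)
       (simp_all add: hom_mult[OF \<Phi>] unipotent_at_0_lower_mult mem \<Phi>S f_def)
  ultimately show ?thesis using \<Phi> by blast
qed

theorem proposition3p2:
  fixes \<Gamma> :: "('g, 'm) monoid_scheme" and n :: nat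
    and B :: "('g \<Rightarrow> complex) set \<Rightarrow> ('g \<Rightarrow> complex) set \<Rightarrow> complex"
  assumes "free_group_of_rank n \<Gamma>"
    and "symmetric_bilinear_form (H1 \<Gamma>) B"
    and "form_rank (H1 \<Gamma>) B \<le> 2"
  shows "\<exists>\<rho> :: real \<Rightarrow> 'g \<Rightarrow> complex^2^2.
    smooth_deformation_of_trivial_character \<Gamma> \<rho> \<and>
    (\<forall>\<gamma>\<in>carrier \<Gamma>.
      (\<lambda>t. character (\<rho> t) \<gamma>
            - (2 + complex_of_real t * B (H1_class \<Gamma> \<gamma>) (H1_class \<Gamma> \<gamma>)))
        \<in> o[at 0](\<lambda>t. complex_of_real t))"
proof -
  from assms(1) obtain S where G: "group \<Gamma>" and S: "finite S" "free_basis \<Gamma> S"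
    by (auto simp: free_group_of_rank_def)
  obtain u v where
    u: "\<And>g h. g \<in> carrier \<Gamma> \<Longrightarrow> h \<in> carrier \<Gamma> \<Longrightarrow> u (g \<otimes>\<^bsub>\<Gamma>\<^esub> h) = u g + u h" and
    v: "\<And>g h. g \<in> carrier \<Gamma> \<Longrightarrow> h \<in> carrier \<Gamma> \<Longrightarrow> v (g \<otimes>\<^bsub>\<Gamma>\<^esub> h) = v g + v h" and
    uv: "\<And>g. g \<in> carrier \<Gamma> \<Longrightarrow> B (H1_class \<Gamma> g) (H1_class \<Gamma> g) = u g * v g"
    using quadratic_form_eq_product[OF G S(2,1) assms(2,3)] by blast
  obtain \<Phi> where \<Phi>: "\<Phi> \<in> hom \<Gamma> unipotent_at_0"
    and \<Phi>u: "\<And>\<gamma>. \<gamma> \<in> carrier \<Gamma> \<Longrightarrow> coeff (\<Phi> \<gamma> $ 1 $ 2) 1 = u \<gamma>"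
    and \<Phi>v: "\<And>\<gamma>. \<gamma> \<in> carrier \<Gamma> \<Longrightarrow> coeff (\<Phi> \<gamma> $ 2 $ 1) 0 = v \<gamma>"
    using ex_hom_unipotent_at_0[OF G S(2), of u v] u v by blast
  define \<rho> where "\<rho> t = eval_matrix t \<circ> \<Phi>" for t
  have char: "character (\<rho> t) \<gamma> = poly (trace (\<Phi> \<gamma>)) (complex_of_real t)" for t \<gamma>
    by (simp add: character_def \<rho>_def trace_eval_matrix)
  have coeffs: "coeff (trace (\<Phi> \<gamma>)) 0 = 2"
    "coeff (trace (\<Phi> \<gamma>)) 1 = B (H1_class \<Gamma> \<gamma>) (H1_class \<Gamma> \<gamma>)" if "\<gamma> \<in> carrier \<Gamma>" for \<gamma>
    using unipotent_at_0_trace[OF hom_in_carrier[OF \<Phi> that]] that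
    by (simp_all add: \<Phi>u \<Phi>v uv del: One_nat_def)
  have "representation \<Gamma> (\<rho> t)" for t
    unfolding representation_def \<rho>_def by (rule hom_compose[OF \<Phi> eval_matrix_hom])
  then have "smooth_deformation_of_trivial_character \<Gamma> \<rho>"
    unfolding smooth_deformation_of_trivial_character_def char
    by (auto simp: smooth_on_poly coeffs poly_0_coeff_0 intro!: exI[of _ 1])
  moreover have "(\<lambda>t. character (\<rho> t) \<gamma>
      - (2 + complex_of_real t * B (H1_class \<Gamma> \<gamma>) (H1_class \<Gamma> \<gamma>)))
      \<in> o[at 0](\<lambda>t. complex_of_real t)" if \<gamma>: "\<gamma> \<in> carrier \<Gamma>" for \<gamma>
  proof -
    define p where "p = trace (\<Phi> \<gamma>) - [:2, B (H1_class \<Gamma> \<gamma>) (H1_class \<Gamma> \<gamma>):]"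
    have "coeff p 0 = 0" "coeff p 1 = 0"
      using coeffs[OF \<gamma>] by (simp_all add: p_def)
    from poly_smallo_linear[OF this] show ?thesis
      by (simp add: p_def char)
  qed
  ultimately show ?thesis by blast
qed

end
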